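(* Let $M$ be a locally compact and totally disconnected pointed metric space. If $M$ is not uniformly discrete, then both $lip(M)$ and $S(M)$ are unconditionally almost square (UASQ).
   Context: All Banach spaces are real; $S_Z$ denotes the unit sphere of a Banach space $Z$. A pointed metric space is a metric space $(M,d)$ with a designated origin $0\in M$; $B(x,r)$ is the open ball. $M$ is uniformly discrete if $\inf_{x\ne y}d(x,y)>0$. $Lip(M)$ is the Banach space of real-valued Lipschitz functions $f$ on $M$ with $f(0)=0$, with norm $\|f\|=\sup_{x\neq y}\frac{|f(x)-f(y)|}{d(x,y)}$. $lip(M)$ is the subspace of those $f\in Lip(M)$ with $\lim_{\varepsilon\to0}\sup_{0<d(x,y)<\varepsilon}\frac{|f(x)-f(y)|}{d(x,y)}=0$. $S(M)$ is the subspace of those $f\in lip(M)$ with $\lim_{r\to\infty}\sup\left\{\frac{|f(x)-f(y)|}{d(x,y)}: x\ne y,\ x\notin B(0,r)\text{ or }y\notin B(0,r)\right\}=0$. Suprema over empty sets are $0$. A Banach space $Z$ is called unconditionally almost square (UASQ) if for each $\varepsilon>0$ there exists a subset $\{x_\gamma\}_{\gamma\in\Gamma}\subseteq S_Z$ (depending on $\varepsilon$) such that: (1) for each finite set $\{y_1,\ldots,y_k\}\subseteq S_Z$ and each $\delta>0$ the set $\{\gamma\in\Gamma : \|y_i\pm x_\gamma\|\le 1+\delta\ \text{for all } i\in\{1,\ldots,k\}\}$ is non-empty; (2) for every finite subset $F$ of $\Gamma$ and every choice of signs $\xi_\gamma\in\{-1,1\}$, $\gamma\in F$, one has $\left\|\sum_{\gamma\in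 F}\xi_\gamma x_\gamma\right\|\le 1+\varepsilon$. *)

theory Defs
  imports "HOL-Analysis.Analysis"
begin

text \<open>
  A pointed metric space is a type of sort \<open>{metric_space, zero}\<close>: the class \<^class>\<open>zero\<close>
  has no axioms, so \<open>0\<close> is an arbitrary designated point.
\<close>

definition totally_disconnected :: "'a::topological_space set \<Rightarrow> bool"
  where "totally_disconnected S \<longleftrightarrow> (\<forall>x\<in>S. connected_component_set S x = {x})"


subsection \<open>Suprema of slopes\<close>

text \<open>
  Slopes are nonnegative, so inserting \<open>0\<close> only serves to make the supremum over the
  empty set equal to \<open>0\<close>; \<^term>\<open>Sup {} :: real\<close> is unspecified.
\<close>

definition slope_sup :: "('a::metric_space \<Rightarrow> real) \<Rightarrow> ('a \<Rightarrow> 'a \<Rightarrow> bool) \<Rightarrow> real"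
  where "slope_sup f P = Sup (insert 0 {\<bar>f x - f y\<bar> / dist x y | x y. x \<noteq> y \<and> P x y})"

definition is_lipschitz :: "('a::metric_space \<Rightarrow> real) \<Rightarrow> bool"
  where "is_lipschitz f \<longleftrightarrow> (\<exists>C. C-lipschitz_on UNIV f)"

lemma is_lipschitzI:
  assumes "0 \<le> C" "\<And>x y. \<bar>f x - f y\<bar> \<le> C * dist x y"
  shows "is_lipschitz f"
  using assms by (auto simp: is_lipschitz_def lipschitz_on_def dist_real_def)

lemma is_lipschitzE:
  assumes "is_lipschitz f"
  obtains C where "0 \<le> C" "\<And>x y. \<bar>f x - f y\<bar> \<le> C * dist x y"
  using assms by (auto simp: is_lipschitz_def lipschitz_on_def dist_real_def)

lemma slope_sup_le:
  assumes "0 \<le> c" "\<And>x y. x \<noteq> y \<Longrightarrow> P x y \<Longrightarrow> \<bar>f x - f y\<bar> \<le> c * dist x y"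
  shows "slope_sup f P \<le> c"
  unfolding slope_sup_def
  by (rule cSup_least) (use assms in \<open>auto simp: pos_divide_le_eq\<close>)

lemma bdd_above_slopes:
  assumes "is_lipschitz f"
  shows "bdd_above (insert 0 {\<bar>f x - f y\<bar> / dist x y | x y. x \<noteq> y \<and> P x y})"
proof -
  obtain C where C: "0 \<le> C" "\<And>x y. \<bar>f x - f y\<bar> \<le> C * dist x y"
    using assms by (rule is_lipschitzE) blast
  show ?thesis
    by (rule bdd_aboveI[of _ C]) (use C in \<open>auto simp: pos_divide_le_eq\<close>)
qed

lemma slope_sup_nonneg:
  assumes "is_lipschitz f"
  shows "0 \<le> slope_sup f P"
  unfolding slope_sup_def by (rule cSup_upper[OF _ bdd_above_slopes[OF assms]]) simp

lemma slope_sup_bound: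
  assumes "is_lipschitz f" "P x y"
  shows "\<bar>f x - f y\<bar> \<le> slope_sup f P * dist x y"
proof (cases "x = y")
  case False
  then have "\<bar>f x - f y\<bar> / dist x y \<le> slope_sup f P"
    unfolding slope_sup_def
    using assms(2) by (intro cSup_upper[OF _ bdd_above_slopes[OF assms(1)]]) blast
  then show ?thesis using False by (simp add: pos_divide_le_eq)
qed simp

lemma slope_sup_mono:
  assumes "is_lipschitz f" "\<And>x y. P x y \<Longrightarrow> Q x y"
  shows "slope_sup f P \<le> slope_sup f Q"
  by (rule slope_sup_le) (use assms in \<open>auto intro: slope_sup_nonneg slope_sup_bound\<close>)

lemma is_lipschitz_zero: "is_lipschitz (\<lambda>x. 0)"
  by (rule is_lipschitzI[of 0]) auto

lemma is_lipschitz_scale: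
  assumes "is_lipschitz f"
  shows "is_lipschitz (\<lambda>x. c * f x)"
proof -
  obtain C where C: "0 \<le> C" "\<And>x y. \<bar>f x - f y\<bar> \<le> C * dist x y"
    using assms by (rule is_lipschitzE) blast
  show ?thesis
  proof (rule is_lipschitzI)
    show "0 \<le> \<bar>c\<bar> * C" using C by simp
    show "\<bar>c * f x - c * f y\<bar> \<le> \<bar>c\<bar> * C * dist x y" for x y
      using mult_left_mono[OF C(2)[of x y], of "\<bar>c\<bar>"]
      by (simp add: abs_mult[symmetric] right_diff_distrib mult.assoc)
  qed
qed

lemma is_lipschitz_add:
  assumes "is_lipschitz f" "is_lipschitz g"
  shows "is_lipschitz (\<lambda>x. f x + g x)"
proof -
  obtain C where C: "0 \<le> C" "\<And>x y. \<bar>f x - f y\<bar> \<le> C * dist x y"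
    using assms(1) by (rule is_lipschitzE) blast
  obtain D where D: "0 \<le> D" "\<And>x y. \<bar>g x - g y\<bar> \<le> D * dist x y"
    using assms(2) by (rule is_lipschitzE) blast
  show ?thesis
  proof (rule is_lipschitzI)
    show "0 \<le> C + D" using C D by simp
    show "\<bar>(f x + g x) - (f y + g y)\<bar> \<le> (C + D) * dist x y" for x y
      using C(2)[of x y] D(2)[of x y] by (simp add: distrib_right)
  qed
qed

lemma slope_sup_add:
  assumes "is_lipschitz f" "is_lipschitz g"
  shows "slope_sup (\<lambda>x. f x + g x) P \<le> slope_sup f P + slope_sup g P"
proof (rule slope_sup_le)
  show "0 \<le> slope_sup f P + slope_sup g P"
    using assms by (simp add: slope_sup_nonneg)
  show "\<bar>(f x + g x) - (f y + g y)\<bar> \<le> (slope_sup f P + slope_sup g P) * dist x y"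
    if "P x y" for x y
    using slope_sup_bound[of f P x y] slope_sup_bound[of g P x y] assms that
    by (simp add: distrib_right)
qed

lemma slope_sup_scale_le:
  assumes "is_lipschitz f"
  shows "slope_sup (\<lambda>x. c * f x) P \<le> \<bar>c\<bar> * slope_sup f P"
proof (rule slope_sup_le)
  show "0 \<le> \<bar>c\<bar> * slope_sup f P" using assms by (simp add: slope_sup_nonneg)
  show "\<bar>c * f x - c * f y\<bar> \<le> \<bar>c\<bar> * slope_sup f P * dist x y" if "P x y" for x y
    using mult_left_mono[OF slope_sup_bound[of f P x y], of "\<bar>c\<bar>"] assms that
    by (simp add: abs_mult[symmetric] right_diff_distrib mult.assoc)
qed

lemma slope_sup_scale:
  assumes "is_lipschitz f"
  shows "slope_sup (\<lambda>x. c * f x) P = \<bar>c\<bar> * slope_sup f P"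
proof (cases "c = 0")
  case True
  have "slope_sup (\<lambda>x. 0) P \<le> 0" by (rule slope_sup_le) auto
  then show ?thesis
    using True slope_sup_nonneg[OF is_lipschitz_zero, of P] by simp
next
  case False
  have "slope_sup (\<lambda>x. inverse c * (c * f x)) P \<le> \<bar>inverse c\<bar> * slope_sup (\<lambda>x. c * f x) P"
    by (rule slope_sup_scale_le) (rule is_lipschitz_scale[OF assms])
  then have "slope_sup f P \<le> \<bar>inverse c\<bar> * slope_sup (\<lambda>x. c * f x) P"
    using False by (simp add: mult.assoc[symmetric])
  then have "\<bar>c\<bar> * slope_sup f P \<le> slope_sup (\<lambda>x. c * f x) P"
    using False by (simp add: field_simps)
  then show ?thesis using slope_sup_scale_le[OF assms, of c P] by simp
qed


subsection \<open>The Banach space of Lipschitz functions vanishing at the origin\<close>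

typedef (overloaded) 'a Lip = "{f :: 'a::{metric_space, zero} \<Rightarrow> real. is_lipschitz f \<and> f 0 = 0}"
  morphisms apply_Lip Abs_Lip
  by (rule exI[of _ "\<lambda>x. 0"]) (simp add: is_lipschitz_zero)

setup_lifting type_definition_Lip

lemma Lip_eqI: "(\<And>x. apply_Lip f x = apply_Lip g x) \<Longrightarrow> f = g"
  by (metis apply_Lip_inject ext)

lemma is_lipschitz_Lip [simp]: "is_lipschitz (apply_Lip f)"
  using apply_Lip by blast

lemma apply_Lip_0 [simp]: "apply_Lip f 0 = 0"
  using apply_Lip by blast

instantiation Lip :: ("{metric_space, zero}") real_vector
begin

lift_definition zero_Lip :: "'a Lip" is "\<lambda>x. 0"
  by (simp add: is_lipschitz_zero)

lift_definition scaleR_Lip :: "real \<Rightarrow> 'a Lip \<Rightarrow> 'a Lip" is "\<lambda>c f x. c * f x"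
  by (simp add: is_lipschitz_scale)

lift_definition plus_Lip :: "'a Lip \<Rightarrow> 'a Lip \<Rightarrow> 'a Lip" is "\<lambda>f g x. f x + g x"
  by (simp add: is_lipschitz_add)

lift_definition uminus_Lip :: "'a Lip \<Rightarrow> 'a Lip" is "\<lambda>f x. - f x"
  using is_lipschitz_scale[of _ "-1"] by auto

lift_definition minus_Lip :: "'a Lip \<Rightarrow> 'a Lip \<Rightarrow> 'a Lip" is "\<lambda>f g x. f x - g x"
  using is_lipschitz_add[OF _ is_lipschitz_scale[of _ "-1"]] by auto

instance
proof
  fix f g h :: "'a Lip" and a b :: real
  show "f + g + h = f + (g + h)" by transfer (simp add: add.assoc)
  show "f + g = g + f" by transfer (simp add: add.commute)
  show "0 + f = f" by transfer simp
  show "- f + f = 0" by transfer simp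
  show "f - g = f + - g" by transfer simp
  show "a *\<^sub>R (f + g) = a *\<^sub>R f + a *\<^sub>R g" by transfer (simp add: distrib_left)
  show "(a + b) *\<^sub>R f = a *\<^sub>R f + b *\<^sub>R f" by transfer (simp add: distrib_right)
  show "a *\<^sub>R b *\<^sub>R f = (a * b) *\<^sub>R f" by transfer (simp add: mult.assoc)
  show "1 *\<^sub>R f = f" by transfer simp
qed

end

instantiation Lip :: ("{metric_space, zero}") real_normed_vector
begin

definition norm_Lip :: "'a Lip \<Rightarrow> real"
  where "norm_Lip f = slope_sup (apply_Lip f) (\<lambda>x y. True)"

definition dist_Lip :: "'a Lip \<Rightarrow> 'a Lip \<Rightarrow> real"
  where "dist_Lip f g = norm (f - g)"

definition sgn_Lip :: "'a Lip \<Rightarrow> 'a Lip"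
  where "sgn_Lip f = f /\<^sub>R norm f"

definition uniformity_Lip :: "('a Lip \<times> 'a Lip) filter"
  where "uniformity_Lip = (INF e\<in>{0 <..}. principal {(x, y). dist x y < e})"

definition open_Lip :: "'a Lip set \<Rightarrow> bool"
  where "open_Lip S = (\<forall>x\<in>S. \<forall>\<^sub>F (x', y) in uniformity. x' = x \<longrightarrow> y \<in> S)"

instance
proof
  fix f g :: "'a Lip" and a :: real
  show "dist f g = norm (f - g)" by (rule dist_Lip_def)
  show "sgn f = f /\<^sub>R norm f" by (rule sgn_Lip_def)
  show "uniformity = (INF e\<in>{0<..}. principal {(x, y :: 'a Lip). dist x y < e})"
    by (rule uniformity_Lip_def)
  show "open U = (\<forall>x\<in>U. \<forall>\<^sub>F (x', y) in uniformity. x' = x \<longrightarrow> y \<in> U)" for U :: "'a Lip set"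
    by (rule open_Lip_def)
  show "norm (a *\<^sub>R f) = \<bar>a\<bar> * norm f"
    by (simp add: norm_Lip_def scaleR_Lip.rep_eq slope_sup_scale)
  show "norm (f + g) \<le> norm f + norm g"
    by (simp add: norm_Lip_def plus_Lip.rep_eq slope_sup_add)
  show "norm f = 0 \<longleftrightarrow> f = 0"
  proof
    assume "norm f = 0"
    then have "\<bar>apply_Lip f x - apply_Lip f 0\<bar> \<le> 0" for x
      using slope_sup_bound[of "apply_Lip f" "\<lambda>x y. True" x 0] by (simp add: norm_Lip_def)
    then show "f = 0" by (intro Lip_eqI) (simp add: zero_Lip.rep_eq)
  next
    assume "f = 0"
    have "slope_sup (\<lambda>x::'a. 0) (\<lambda>x y. True) = 0"
      by (intro antisym slope_sup_le slope_sup_nonneg is_lipschitz_zero) auto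
    with \<open>f = 0\<close> show "norm f = 0" by (simp add: norm_Lip_def zero_Lip.rep_eq)
  qed
qed

end

lemma norm_Lip_bound: "\<bar>apply_Lip f x - apply_Lip f y\<bar> \<le> norm f * dist x y"
  unfolding norm_Lip_def by (rule slope_sup_bound) simp_all

lemma norm_Lip_le:
  assumes "0 \<le> c" "\<And>x y. \<bar>apply_Lip f x - apply_Lip f y\<bar> \<le> c * dist x y"
  shows "norm f \<le> c"
  unfolding norm_Lip_def using assms by (intro slope_sup_le)

instance Lip :: ("{metric_space, zero}") banach
proof
  fix X :: "nat \<Rightarrow> 'a Lip"
  assume X: "Cauchy X"
  have diff: "\<bar>(apply_Lip (X m) x - apply_Lip (X n) x) - (apply_Lip (X m) y - apply_Lip (X n) y)\<bar>
      \<le> norm (X m - X n) * dist x y" for m n x y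
    using norm_Lip_bound[of "X m - X n" x y] by (simp add: minus_Lip.rep_eq)
  have "Cauchy (\<lambda>n. apply_Lip (X n) x)" for x
  proof (rule CauchyI)
    fix e :: real assume "0 < e"
    then have "0 < e / (dist x 0 + 1)" by (simp add: add_nonneg_pos)
    then obtain N where N: "\<And>m n. m \<ge> N \<Longrightarrow> n \<ge> N \<Longrightarrow> norm (X m - X n) < e / (dist x 0 + 1)"
      using CauchyD[OF X] by blast
    have "norm (apply_Lip (X m) x - apply_Lip (X n) x) < e" if "m \<ge> N" "n \<ge> N" for m n
    proof -
      have "\<bar>apply_Lip (X m) x - apply_Lip (X n) x\<bar> \<le> norm (X m - X n) * dist x 0"
        using diff[of m x n 0] by simp
      also have "\<dots> \<le> norm (X m - X n) * (dist x 0 + 1)" by (intro mult_left_mono) auto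
      also have "\<dots> < e" using N[OF that] by (simp add: pos_less_divide_eq add_nonneg_pos)
      finally show ?thesis by simp
    qed
    then show "\<exists>M. \<forall>m\<ge>M. \<forall>n\<ge>M. norm (apply_Lip (X m) x - apply_Lip (X n) x) < e" by blast
  qed
  then have "\<exists>l. (\<lambda>n. apply_Lip (X n) x) \<longlonglongrightarrow> l" for x
    using Cauchy_convergent convergent_def by blast
  then obtain g where g: "\<And>x. (\<lambda>n. apply_Lip (X n) x) \<longlonglongrightarrow> g x" by metis
  have tail: "\<bar>(apply_Lip (X m) x - g x) - (apply_Lip (X m) y - g y)\<bar> \<le> e * dist x y"
    if N: "\<And>n. n \<ge> N \<Longrightarrow> norm (X m - X n) \<le> e" for e m N x y
  proof (rule LIMSEQ_le_const2)
    show "(\<lambda>n. \<bar>(apply_Lip (X m) x - apply_Lip (X n) x) - (apply_Lip (X m) y - apply_Lip (X n) y)\<bar>)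
        \<longlonglongrightarrow> \<bar>(apply_Lip (X m) x - g x) - (apply_Lip (X m) y - g y)\<bar>"
      by (intro tendsto_intros g)
    show "\<exists>N. \<forall>n\<ge>N. \<bar>(apply_Lip (X m) x - apply_Lip (X n) x)
        - (apply_Lip (X m) y - apply_Lip (X n) y)\<bar> \<le> e * dist x y"
      using N by (intro exI[of _ N] allI impI order_trans[OF diff] mult_right_mono) auto
  qed
  obtain N1 where N1: "\<And>m n. m \<ge> N1 \<Longrightarrow> n \<ge> N1 \<Longrightarrow> norm (X m - X n) < 1"
    using CauchyD[OF X, of 1] by auto
  have "is_lipschitz g"
  proof (rule is_lipschitzI)
    show "0 \<le> norm (X N1) + 1" by simp
    show "\<bar>g x - g y\<bar> \<le> (norm (X N1) + 1) * dist x y" for x y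
      using tail[where e = 1 and m = N1 and N = N1 and x = x and y = y]
        norm_Lip_bound[of "X N1" x y] N1
      by (fastforce simp: distrib_right less_imp_le)
  qed
  moreover have "g 0 = 0"
    using g[of 0] by (simp add: LIMSEQ_const_iff)
  ultimately have G: "apply_Lip (Abs_Lip g) = g" by (simp add: Abs_Lip_inverse)
  have "X \<longlonglongrightarrow> Abs_Lip g"
  proof (rule LIMSEQ_I)
    fix e :: real assume "0 < e"
    then obtain N where N: "\<And>m n. m \<ge> N \<Longrightarrow> n \<ge> N \<Longrightarrow> norm (X m - X n) < e / 2"
      using CauchyD[OF X, of "e / 2"] by auto
    have "norm (X m - Abs_Lip g) \<le> e / 2" if "m \<ge> N" for m
    proof (rule norm_Lip_le)
      show "0 \<le> e / 2" using \<open>0 < e\<close> by simp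
      show "\<bar>apply_Lip (X m - Abs_Lip g) x - apply_Lip (X m - Abs_Lip g) y\<bar> \<le> e / 2 * dist x y"
        for x y
        unfolding minus_Lip.rep_eq G by (rule tail[of N]) (use N that in \<open>auto intro: less_imp_le\<close>)
    qed
    then show "\<exists>no. \<forall>n\<ge>no. norm (X n - Abs_Lip g) < e"
      using \<open>0 < e\<close> by (intro exI[of _ N]) fastforce
  qed
  then show "convergent X" by (auto simp: convergent_def)
qed


subsection \<open>The subspaces \<open>lip(M)\<close> and \<open>S(M)\<close>\<close>

definition little_lip :: "'a::{metric_space, zero} Lip set"
  where "little_lip =
    {f. ((\<lambda>\<epsilon>. slope_sup (apply_Lip f) (\<lambda>x y. dist x y < \<epsilon>)) \<longlongrightarrow> 0) (at_right 0)}"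

definition S_lip :: "'a::{metric_space, zero} Lip set"
  where "S_lip = {f \<in> little_lip.
    ((\<lambda>r. slope_sup (apply_Lip f) (\<lambda>x y. x \<notin> ball 0 r \<or> y \<notin> ball 0 r)) \<longlongrightarrow> 0) at_top}"

lemma subspace_slope_limit:
  fixes P :: "real \<Rightarrow> 'a::{metric_space, zero} \<Rightarrow> 'a \<Rightarrow> bool"
  shows "subspace {f. ((\<lambda>t. slope_sup (apply_Lip f) (P t)) \<longlongrightarrow> 0) F}"
proof (rule subspaceI)
  have "slope_sup (apply_Lip (0 :: 'a Lip)) (P t) = 0" for t
    using slope_sup_scale[OF is_lipschitz_Lip[of 0], of 0 "P t"] by (simp add: zero_Lip.rep_eq)
  then show "0 \<in> {f. ((\<lambda>t. slope_sup (apply_Lip f) (P t)) \<longlongrightarrow> 0) F}" by simp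
next
  fix f g :: "'a Lip"
  assume "f \<in> {f. ((\<lambda>t. slope_sup (apply_Lip f) (P t)) \<longlongrightarrow> 0) F}"
    and "g \<in> {f. ((\<lambda>t. slope_sup (apply_Lip f) (P t)) \<longlongrightarrow> 0) F}"
  then have "((\<lambda>t. slope_sup (apply_Lip f) (P t) + slope_sup (apply_Lip g) (P t)) \<longlongrightarrow> 0 + 0) F"
    by (intro tendsto_add) auto
  then have "((\<lambda>t. slope_sup (apply_Lip (f + g)) (P t)) \<longlongrightarrow> 0) F"
    by (intro tendsto_sandwich[OF _ _ tendsto_const, of 0 "\<lambda>t. slope_sup (apply_Lip (f + g)) (P t)"
          F "\<lambda>t. slope_sup (apply_Lip f) (P t) + slope_sup (apply_Lip g) (P t)"] always_eventually)
      (auto simp: slope_sup_nonneg plus_Lip.rep_eq[of f g] slope_sup_add is_lipschitz_add)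
  then show "f + g \<in> {f. ((\<lambda>t. slope_sup (apply_Lip f) (P t)) \<longlongrightarrow> 0) F}" by simp
next
  fix c :: real and f :: "'a Lip"
  assume "f \<in> {f. ((\<lambda>t. slope_sup (apply_Lip f) (P t)) \<longlongrightarrow> 0) F}"
  then have "((\<lambda>t. \<bar>c\<bar> * slope_sup (apply_Lip f) (P t)) \<longlongrightarrow> \<bar>c\<bar> * 0) F"
    by (intro tendsto_mult tendsto_const) auto
  then show "c *\<^sub>R f \<in> {f. ((\<lambda>t. slope_sup (apply_Lip f) (P t)) \<longlongrightarrow> 0) F}"
    by (simp add: scaleR_Lip.rep_eq slope_sup_scale)
qed

lemma closed_slope_limit:
  fixes P :: "real \<Rightarrow> 'a::{metric_space, zero} \<Rightarrow> 'a \<Rightarrow> bool"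
  shows "closed {f. ((\<lambda>t. slope_sup (apply_Lip f) (P t)) \<longlongrightarrow> 0) F}" (is "closed ?Z")
proof -
  have "f \<in> ?Z" if f: "\<forall>e>0. \<exists>g\<in>?Z. dist g f < e" for f
  proof -
    have "\<forall>\<^sub>F t in F. dist (slope_sup (apply_Lip f) (P t)) 0 < e" if "0 < e" for e
    proof -
      obtain g where g: "g \<in> ?Z" and fg: "dist g f < e / 2"
        using f \<open>0 < e\<close> by (meson half_gt_zero)
      have "\<forall>\<^sub>F t in F. dist (slope_sup (apply_Lip g) (P t)) 0 < e / 2"
        using g \<open>0 < e\<close> by (intro tendstoD) auto
      then show ?thesis
      proof (rule eventually_mono)
        fix t assume t: "dist (slope_sup (apply_Lip g) (P t)) 0 < e / 2"
        have "slope_sup (apply_Lip f) (P t) = slope_sup (\<lambda>x. apply_Lip g x + apply_Lip (f - g) x) (P t)"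
          by (simp add: minus_Lip.rep_eq)
        also have "\<dots> \<le> slope_sup (apply_Lip g) (P t) + slope_sup (apply_Lip (f - g)) (P t)"
          by (intro slope_sup_add) auto
        also have "slope_sup (apply_Lip (f - g)) (P t) \<le> norm (f - g)"
          unfolding norm_Lip_def by (intro slope_sup_mono) auto
        finally show "dist (slope_sup (apply_Lip f) (P t)) 0 < e"
          using t fg slope_sup_nonneg[OF is_lipschitz_Lip[of f], of "P t"]
          by (simp add: dist_norm norm_minus_commute)
      qed
    qed
    then show "f \<in> ?Z" by (simp add: tendsto_iff)
  qed
  then show ?thesis using closure_approachable[of _ ?Z] closure_subset_eq[of ?Z] by blast
qed

lemma subspace_little_lip: "subspace little_lip"
  unfolding little_lip_def by (rule subspace_slope_limit)

lemma closed_little_lip: "closed little_lip"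
  unfolding little_lip_def by (rule closed_slope_limit)

lemma subspace_S_lip: "subspace S_lip"
  unfolding S_lip_def Collect_conj_eq Collect_mem_eq
  by (intro subspace_inter subspace_little_lip subspace_slope_limit)

lemma closed_S_lip: "closed S_lip"
  unfolding S_lip_def Collect_conj_eq Collect_mem_eq
  by (intro closed_Int closed_little_lip closed_slope_limit)


subsection \<open>Unconditionally almost square Banach spaces\<close>

text \<open>
  The Banach space \<open>Z\<close> is given as a closed linear subspace of an ambient Banach space, with
  unit sphere \<^term>\<open>Z \<inter> sphere 0 1\<close>. The set \<open>X\<close> below, indexed by itself, is the
  set \<open>{x\<^sub>\<gamma>}\<close>.
\<close>

definition uasq :: "'b::banach set \<Rightarrow> bool"
  where "uasq Z \<longleftrightarrow> subspace Z \<and> closed Z \<and>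
    (\<forall>\<epsilon>>0. \<exists>X \<subseteq> Z \<inter> sphere 0 1.
      (\<forall>Y \<delta>. finite Y \<longrightarrow> Y \<subseteq> Z \<inter> sphere 0 1 \<longrightarrow> \<delta> > 0 \<longrightarrow>
        {x \<in> X. \<forall>y\<in>Y. norm (y + x) \<le> 1 + \<delta> \<and> norm (y - x) \<le> 1 + \<delta>} \<noteq> {}) \<and>
      (\<forall>F \<xi>. finite F \<longrightarrow> F \<subseteq> X \<longrightarrow> \<xi> ` F \<subseteq> {-1, 1} \<longrightarrow>
        norm (\<Sum>x\<in>F. \<xi> x *\<^sub>R x) \<le> 1 + \<epsilon>))"

end

theory Submission
  imports Defs
begin

text \<open>
  A compact open set \<open>K\<close> with \<open>\<emptyset> \<noteq> K \<noteq> M\<close> lies at a positive distance \<open>c\<close> from its complement.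
  So the step function \<open>c \<cdot> 1\<^sub>K\<close>, shifted by a constant so as to vanish at the origin, has
  Lipschitz norm exactly \<open>1\<close> and takes only two values, which differ by \<open>c\<close>; it is constant on
  every ball of radius \<open>c\<close>, and it lies in \<open>S(M)\<close> because \<open>K\<close> is bounded. In a locally
  compact totally disconnected space any two points \<open>p \<noteq> q\<close> are separated by such a \<open>K\<close>, and then
  \<open>c \<le> d(p,q)\<close>. If \<open>M\<close> is not uniformly discrete, this produces functions of norm \<open>1\<close>
  with arbitrarily small sup norm (lemma \<open>ex_small_step_function\<close>).

  Everything else rests on one estimate, \<open>norm_add_le_scales\<close>. If the slopes of \<open>f\<close> at distances
  below \<open>t\<close> are at most \<open>d\<close>, and the sup norm of \<open>g\<close> is tiny in comparison with \<open>t\<close>, then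
  \<open>f\<close> and \<open>g\<close> act at different scales: at distances below \<open>t\<close> only \<open>g\<close> matters, above \<open>t\<close> only
  \<open>f\<close> does. Hence \<open>\<parallel>f + g\<parallel>\<close> exceeds \<open>max \<parallel>f\<parallel> \<parallel>g\<parallel>\<close> by little. It is used twice.
  For \<open>f\<close> in \<open>lip(M)\<close>, such a scale \<open>t\<close> exists for each \<open>d > 0\<close>, so that any sequence of step
  functions whose sup norms tend to zero satisfies the first condition of almost squareness.
  For \<open>f\<close> a signed sum of step functions, one can take \<open>d = 0\<close>; so if each step
  function is chosen tiny in comparison with the gaps of the previous ones, the norm of a signed
  sum grows by at most \<open>\<epsilon> / 2 ^ Suc n\<close> at the \<open>n\<close>-th step, which is the second condition.
\<close>

section \<open>Compact open sets\<close>

lemma ex_compact_open_separating: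
  fixes p q :: "'a::metric_space"
  assumes lc: "locally_compact_space (euclidean :: 'a topology)"
    and td: "totally_disconnected (UNIV :: 'a set)"
    and "p \<noteq> q"
  obtains K where "compact K" "open K" "p \<in> K" "q \<notin> K"
proof -
  obtain W L where WL: "open W" "compact L" "p \<in> W" "W \<subseteq> L"
    using lc unfolding locally_compact_space_def by (simp (no_asm_use)) blast
  have "{p} \<in> connected_components_of (euclidean :: 'a topology)"
  proof -
    have "connected_component_of_set (euclidean :: 'a topology) p = connected_component_set UNIV p"
      by (auto simp: connected_component_of_def connected_component_def)
    then show ?thesis
      using td unfolding totally_disconnected_def connected_components_of_def by auto
  qed
  moreover have "compactin euclidean {p}" by simp
  moreover have "openin euclidean (W - {q})" "{p} \<subseteq> W - {q}"
    using WL \<open>p \<noteq> q\<close> by auto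
  \<comment> \<open>The component \<open>{p}\<close> is compact, so it has a clopen neighbourhood inside any
    neighbourhood.\<close>
  ultimately obtain U V where "openin euclidean U" "openin euclidean V" "disjnt U V"
      "U \<union> V = topspace euclidean" "{p} \<subseteq> U" "U \<subseteq> W - {q}"
    by (rule wilder_locally_compact_component_thm[OF lc Hausdorff_space_euclidean])
  then have UV: "open U" "open V" "disjnt U V" "U \<union> V = UNIV" "p \<in> U" "U \<subseteq> W - {q}"
    by simp_all
  have "U = - V" using UV by (auto simp: disjnt_iff)
  then have "closed U" using UV by auto
  then have "compact U"
    using compact_Int_closed[OF \<open>compact L\<close> \<open>closed U\<close>] UV WL by (simp add: Int_absorb1 subset_iff)
  with UV show ?thesis by (intro that[of U]) auto
qed

lemma compact_open_gap:
  fixes K :: "'a::metric_space set"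
  assumes "compact K" "open K" "K \<noteq> {}" "K \<noteq> UNIV"
  shows "0 < setdist K (- K)"
proof -
  obtain e where "0 < e" "(\<Union>x\<in>K. ball x e) \<subseteq> K"
    by (rule compact_subset_open_imp_ball_epsilon_subset[OF assms(1,2) order_refl])
  then have "y \<notin> ball x e" if "x \<in> K" "y \<notin> K" for x y
    using that by blast
  then have "e \<le> setdist K (- K)"
    using assms by (intro le_setdistI) (auto simp: not_less)
  with \<open>0 < e\<close> show ?thesis by simp
qed


section \<open>Step functions\<close>

text \<open>
  In a space without connectedness, a function may be constant on every ball of a fixed radius
  without being constant: the values jump only across gaps of length at least \<open>t\<close>.
\<close>

definition const_below :: "real \<Rightarrow> ('a::metric_space \<Rightarrow> real) \<Rightarrow> bool"
  where "const_below t f \<longleftrightarrow> (\<forall>x y. dist x y < t \<longrightarrow> f x = f y)"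

lemma const_below_mono: "const_below t f \<Longrightarrow> s \<le> t \<Longrightarrow> const_below s f"
  by (auto simp: const_below_def)

lemma little_lip_if_const_below:
  assumes "0 < t" "const_below t (apply_Lip f)"
  shows "f \<in> little_lip"
proof -
  have "slope_sup (apply_Lip f) (\<lambda>x y. dist x y < e) = 0" if "e < t" for e
  proof (rule antisym)
    have "apply_Lip f x = apply_Lip f y" if "dist x y < e" for x y
      using assms(2) that \<open>e < t\<close> unfolding const_below_def by (meson less_trans)
    then show "slope_sup (apply_Lip f) (\<lambda>x y. dist x y < e) \<le> 0"
      by (intro slope_sup_le) simp_all
  qed (rule slope_sup_nonneg[OF is_lipschitz_Lip])
  then have "\<forall>\<^sub>F e in at_right 0. slope_sup (apply_Lip f) (\<lambda>x y. dist x y < e) = 0"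
    unfolding eventually_at_right_field using \<open>0 < t\<close> by blast
  then show ?thesis by (simp add: little_lip_def tendsto_eventually)
qed

lemma ex_step_function:
  fixes K :: "'a::{metric_space, zero} set"
  assumes "compact K" "open K" "K \<noteq> {}" "K \<noteq> UNIV"
  obtains g :: "'a Lip" where "g \<in> S_lip" "norm g = 1" "const_below (setdist K (- K)) (apply_Lip g)"
    "\<And>x. \<bar>apply_Lip g x\<bar> \<le> setdist K (- K)"
proof -
  define c where "c = setdist K (- K)"
  have "0 < c" unfolding c_def by (rule compact_open_gap[OF assms])
  have c_le: "c \<le> dist x y" if "x \<in> K \<longleftrightarrow> y \<notin> K" for x y
    using setdist_le_dist[of x K y "- K"] setdist_le_dist[of y K x "- K"] that
    by (auto simp: c_def dist_commute)
  define h where "h x = c * (indicat_real K x - indicat_real K 0)" for x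
  have h_diff: "\<bar>h x - h y\<bar> = (if x \<in> K \<longleftrightarrow> y \<in> K then 0 else c)" for x y
    using \<open>0 < c\<close> by (auto simp: h_def indicator_def)
  have h_lip: "\<bar>h x - h y\<bar> \<le> 1 * dist x y" for x y
    using c_le[of x y] by (auto simp: h_diff)
  have "is_lipschitz h" by (rule is_lipschitzI[of 1]) (use h_lip in auto)
  define g where "g = Abs_Lip h"
  have g: "apply_Lip g = h"
    using \<open>is_lipschitz h\<close> by (simp add: g_def Abs_Lip_inverse h_def)
  have "norm g \<le> 1" by (rule norm_Lip_le) (simp, simp only: g h_lip)
  moreover have "1 \<le> norm g"
  proof (rule ccontr)
    assume "\<not> 1 \<le> norm g"
    \<comment> \<open>The infimum \<open>c\<close> need not be attained, but some pair across the gap is closer than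
      \<open>c / \<parallel>g\<parallel>\<close>; the denominator is positive since \<open>g\<close> is not constant.\<close>
    moreover obtain a b where "a \<in> K" "b \<notin> K" using assms by auto
    then have "c \<le> norm g * dist a b"
      using norm_Lip_bound[of g a b] by (simp add: g h_diff)
    then have "norm g \<noteq> 0" using \<open>0 < c\<close> by auto
    then have "0 < norm g" using norm_ge_zero[of g] by linarith
    ultimately have "c < c / norm g" using \<open>0 < c\<close> by (simp add: field_simps)
    then obtain x y where "x \<in> K" "y \<notin> K" "dist x y < c / norm g"
      using setdist_ltE[of K "- K" "c / norm g"] assms by (auto simp: c_def)
    moreover from this have "c \<le> norm g * dist x y"
      using norm_Lip_bound[of g x y] by (simp add: g h_diff)
    ultimately show False
      using \<open>0 < norm g\<close> by (simp add: pos_less_divide_eq mult.commute)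
  qed
  ultimately have "norm g = 1" by simp
  have cb: "const_below c (apply_Lip g)"
    using c_le h_diff \<open>0 < c\<close> unfolding const_below_def g
    by (metis abs_0_eq eq_iff_diff_eq_0 not_less)
  have "g \<in> S_lip"
  proof -
    obtain R where R: "K \<subseteq> ball 0 R"
      using bounded_subset_ballD[OF compact_imp_bounded[OF \<open>compact K\<close>], of 0] by auto
    let ?s = "\<lambda>r. slope_sup (apply_Lip g) (\<lambda>x y. x \<notin> ball 0 r \<or> y \<notin> ball 0 r)"
    have "?s r \<le> c / (r - R)" if "R < r" for r
    proof (rule slope_sup_le)
      show "0 \<le> c / (r - R)" using that \<open>0 < c\<close> by simp
      fix x y :: 'a assume out: "x \<notin> ball 0 r \<or> y \<notin> ball 0 r"
      have "r - R \<le> dist x y" if "x \<in> K \<longleftrightarrow> y \<notin> K"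
        \<comment> \<open>One of the points lies in \<open>K \<subseteq> ball 0 R\<close>, so it must be the other one that
          lies outside \<open>ball 0 r\<close>.\<close>
      proof -
        have "dist 0 x < R \<and> r \<le> dist 0 y \<or> dist 0 y < R \<and> r \<le> dist 0 x"
        proof (cases "x \<in> K")
          case True
          then have "dist 0 x < R" using R by auto
          with out \<open>R < r\<close> show ?thesis by auto
        next
          case False
          then have "dist 0 y < R" using R that by auto
          with out \<open>R < r\<close> show ?thesis by auto
        qed
        then show ?thesis
          using dist_triangle[of 0 x y] dist_triangle[of 0 y x] by (auto simp: dist_commute)
      qed
      then have "c * (r - R) \<le> c * dist x y" if "x \<in> K \<longleftrightarrow> y \<notin> K"
        using that \<open>0 < c\<close> by simp
      then show "\<bar>apply_Lip g x - apply_Lip g y\<bar> \<le> c / (r - R) * dist x y"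
        using that \<open>0 < c\<close> by (auto simp: g h_diff pos_le_divide_eq)
    qed
    then have upper: "\<forall>\<^sub>F r in at_top. ?s r \<le> c / (r - R)"
      by (rule eventually_mono[OF eventually_gt_at_top])
    have lim: "((\<lambda>r. c / (r - R)) \<longlongrightarrow> 0) at_top"
    proof (rule real_tendsto_divide_at_top[OF tendsto_const])
      show "filterlim (\<lambda>r. r - R) at_top at_top"
        using filterlim_tendsto_add_at_top[OF tendsto_const[of "- R"] filterlim_ident] by simp
    qed
    have "\<forall>\<^sub>F r in at_top. 0 \<le> ?s r"
      by (simp add: slope_sup_nonneg)
    then have "(?s \<longlongrightarrow> 0) at_top"
      by (rule tendsto_sandwich[OF _ upper tendsto_const lim])
    then show ?thesis
      using little_lip_if_const_below[OF \<open>0 < c\<close> cb] by (simp add: S_lip_def)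
  qed
  moreover have "\<bar>apply_Lip g x\<bar> \<le> c" for x
    using h_diff[of x 0] \<open>0 < c\<close> by (auto simp: g h_def split: if_splits)
  ultimately show ?thesis
    using that[OF _ \<open>norm g = 1\<close> cb[unfolded c_def]] by (simp only: c_def)
qed

text \<open>
  The gap around a compact open set separating \<open>p\<close> from \<open>q\<close> is at most \<open>dist p q\<close>, and this
  distance can be as small as desired.
\<close>

lemma ex_small_step_function:
  assumes lc: "locally_compact_space (euclidean :: 'a::{metric_space, zero} topology)"
    and td: "totally_disconnected (UNIV :: 'a set)"
    and nud: "\<not> uniform_discrete (UNIV :: 'a set)"
    and "0 < \<eta>"
  obtains g :: "'a::{metric_space, zero} Lip" and t where "g \<in> S_lip" "norm g = 1" "0 < t"
    "const_below t (apply_Lip g)" "\<And>x. \<bar>apply_Lip g x\<bar> \<le> \<eta>"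
proof -
  obtain p q :: 'a where pq: "p \<noteq> q" "dist p q < \<eta>"
    using nud \<open>0 < \<eta>\<close> unfolding uniform_discrete_def by blast
  obtain K where K: "compact K" "open K" "p \<in> K" "q \<notin> K"
    using ex_compact_open_separating[OF lc td \<open>p \<noteq> q\<close>] .
  then have ne: "K \<noteq> {}" "K \<noteq> UNIV" by auto
  have gap: "setdist K (- K) \<le> \<eta>"
    using setdist_le_dist[of p K q "- K"] K pq by simp
  obtain g :: "'a Lip" where g: "g \<in> S_lip" "norm g = 1"
    "const_below (setdist K (- K)) (apply_Lip g)" "\<And>x. \<bar>apply_Lip g x\<bar> \<le> setdist K (- K)"
    using ex_step_function[OF K(1,2) ne] by blast
  show ?thesis
    by (rule that[OF g(1,2) compact_open_gap[OF K(1,2) ne] g(3) order_trans[OF g(4) gap]])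
qed


section \<open>Sums of functions that act at different scales\<close>

lemma norm_add_le_scales:
  assumes "0 < t"
    and near: "\<And>x y. dist x y < t \<Longrightarrow> \<bar>apply_Lip f x - apply_Lip f y\<bar> \<le> d * dist x y"
    and small: "\<And>x. \<bar>apply_Lip g x\<bar> \<le> \<eta> * t"
  shows "norm (f + g) \<le> max (norm f + 2 * \<eta>) (d + norm g)"
proof (rule norm_Lip_le)
  have "0 \<le> \<eta> * t" using small[of 0] by simp
  then have "0 \<le> \<eta>" using \<open>0 < t\<close> by (simp add: zero_le_mult_iff)
  then show "0 \<le> max (norm f + 2 * \<eta>) (d + norm g)" by (simp add: max.coboundedI1)
  fix x y
  have split: "\<bar>apply_Lip (f + g) x - apply_Lip (f + g) y\<bar>
      \<le> \<bar>apply_Lip f x - apply_Lip f y\<bar> + \<bar>apply_Lip g x - apply_Lip g y\<bar>"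
    by (simp add: plus_Lip.rep_eq)
  show "\<bar>apply_Lip (f + g) x - apply_Lip (f + g) y\<bar>
      \<le> max (norm f + 2 * \<eta>) (d + norm g) * dist x y"
  proof (cases "dist x y < t")
    case True
    have "\<bar>apply_Lip (f + g) x - apply_Lip (f + g) y\<bar> \<le> (d + norm g) * dist x y"
      using split near[OF True] norm_Lip_bound[of g x y] by (simp add: distrib_right)
    also have "\<dots> \<le> max (norm f + 2 * \<eta>) (d + norm g) * dist x y"
      by (intro mult_right_mono) auto
    finally show ?thesis .
  next
    case False
    have "\<bar>apply_Lip g x - apply_Lip g y\<bar> \<le> 2 * \<eta> * t"
      using small[of x] small[of y] by linarith
    also have "\<dots> \<le> 2 * \<eta> * dist x y"
      using False \<open>0 \<le> \<eta>\<close> by (intro mult_left_mono) auto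
    finally have "\<bar>apply_Lip (f + g) x - apply_Lip (f + g) y\<bar> \<le> (norm f + 2 * \<eta>) * dist x y"
      using split norm_Lip_bound[of f x y] by (simp add: distrib_right)
    also have "\<dots> \<le> max (norm f + 2 * \<eta>) (d + norm g) * dist x y"
      by (intro mult_right_mono) auto
    finally show ?thesis .
  qed
qed

lemma little_lip_slopes_small:
  fixes f :: "'a::{metric_space, zero} Lip"
  assumes "f \<in> little_lip" "0 < d"
  obtains t where "0 < t"
    "\<And>x y. dist x y < t \<Longrightarrow> \<bar>apply_Lip f x - apply_Lip f y\<bar> \<le> d * dist x y"
proof -
  have "\<forall>\<^sub>F e in at_right 0. slope_sup (apply_Lip f) (\<lambda>x y. dist x y < e) < d"
    using assms by (intro order_tendstoD) (auto simp: little_lip_def)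
  then obtain b where "0 < b"
    and b: "\<And>e. 0 < e \<Longrightarrow> e < b \<Longrightarrow> slope_sup (apply_Lip f) (\<lambda>x y. dist x y < e) < d"
    by (auto simp: eventually_at_right_field)
  show ?thesis
  proof (rule that)
    show "0 < b / 2" using \<open>0 < b\<close> by simp
    fix x y :: 'a assume "dist x y < b / 2"
    then have "\<bar>apply_Lip f x - apply_Lip f y\<bar>
        \<le> slope_sup (apply_Lip f) (\<lambda>x y. dist x y < b / 2) * dist x y"
      by (intro slope_sup_bound) auto
    also have "\<dots> \<le> d * dist x y"
      using b[of "b / 2"] \<open>0 < b\<close> by (intro mult_right_mono) auto
    finally show "\<bar>apply_Lip f x - apply_Lip f y\<bar> \<le> d * dist x y" .
  qed
qed

lemma const_below_sum:
  assumes "\<And>i. i \<in> I \<Longrightarrow> const_below t (apply_Lip (x i))"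
  shows "const_below t (apply_Lip (\<Sum>i\<in>I. \<xi> i *\<^sub>R x i))"
  using assms
  by (induction I rule: infinite_finite_induct)
    (auto simp: const_below_def zero_Lip.rep_eq plus_Lip.rep_eq scaleR_Lip.rep_eq)

text \<open>
  The number \<open>t n\<close> is a scale below which the functions chosen before \<open>x n\<close> are all constant; so
  \<open>x n\<close> is small in comparison with their gaps, and the norm grows by at most
  \<open>2 * (\<epsilon> / 2 ^ (n + 2))\<close> when \<open>x n\<close> joins a signed sum of them.
\<close>

lemma norm_signed_sum_le:
  fixes x :: "nat \<Rightarrow> 'a::{metric_space, zero} Lip"
  assumes "0 \<le> \<epsilon>"
    and norm: "\<And>n. norm (x n) = 1"
    and pos: "\<And>n. 0 < t n"
    and small: "\<And>n z. \<bar>apply_Lip (x n) z\<bar> \<le> \<epsilon> / 2 ^ (n + 2) * t n"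
    and const: "\<And>k n. k < n \<Longrightarrow> const_below (t n) (apply_Lip (x k))"
    and sign: "\<And>n. n \<in> I \<Longrightarrow> \<bar>\<xi> n\<bar> = 1"
  shows "I \<subseteq> {..<n} \<Longrightarrow> norm (\<Sum>i\<in>I. \<xi> i *\<^sub>R x i) \<le> 1 + \<epsilon> * (1 - 1 / 2 ^ n)"
  using sign
proof (induction n arbitrary: I)
  case 0
  then show ?case by simp
next
  case (Suc n)
  let ?f = "\<Sum>i\<in>I - {n}. \<xi> i *\<^sub>R x i"
  have sub: "I - {n} \<subseteq> {..<n}" using Suc.prems(1) by (auto simp: less_Suc_eq)
  have IH: "norm ?f \<le> 1 + \<epsilon> * (1 - 1 / 2 ^ n)"
    using Suc.IH[OF sub] Suc.prems(2) by simp
  have step: "1 + \<epsilon> * (1 - 1 / 2 ^ n) + 2 * (\<epsilon> / 2 ^ (n + 2)) = 1 + \<epsilon> * (1 - 1 / 2 ^ Suc n)"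
    by (simp add: field_simps)
  show ?case
  proof (cases "n \<in> I")
    case True
    have "finite I" using Suc.prems(1) finite_subset by blast
    then have "(\<Sum>i\<in>I. \<xi> i *\<^sub>R x i) = ?f + \<xi> n *\<^sub>R x n"
      using True by (simp add: sum.remove add.commute)
    also have "norm \<dots> \<le> max (norm ?f + 2 * (\<epsilon> / 2 ^ (n + 2))) (0 + norm (\<xi> n *\<^sub>R x n))"
    proof (rule norm_add_le_scales)
      show "0 < t n" by (rule pos)
      have "const_below (t n) (apply_Lip ?f)"
        using sub by (intro const_below_sum const) auto
      then show "\<bar>apply_Lip ?f y - apply_Lip ?f z\<bar> \<le> 0 * dist y z" if "dist y z < t n" for y z
        using that by (auto simp: const_below_def)
      show "\<bar>apply_Lip (\<xi> n *\<^sub>R x n) z\<bar> \<le> \<epsilon> / 2 ^ (n + 2) * t n" for z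
        using small[of n z] Suc.prems(2)[OF True] by (simp add: scaleR_Lip.rep_eq abs_mult)
    qed
    also have "\<dots> \<le> 1 + \<epsilon> * (1 - 1 / 2 ^ Suc n)"
    proof (rule max.boundedI)
      show "norm ?f + 2 * (\<epsilon> / 2 ^ (n + 2)) \<le> 1 + \<epsilon> * (1 - 1 / 2 ^ Suc n)"
        using IH step by linarith
      show "0 + norm (\<xi> n *\<^sub>R x n) \<le> 1 + \<epsilon> * (1 - 1 / 2 ^ Suc n)"
        using Suc.prems(2)[OF True] \<open>0 \<le> \<epsilon>\<close> one_le_power[of "2 :: real" "Suc n"]
        by (simp add: norm del: one_le_power)
    qed
    finally show ?thesis .
  next
    case False
    moreover have "0 \<le> 2 * (\<epsilon> / 2 ^ (n + 2))" using \<open>0 \<le> \<epsilon>\<close> by simp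
    ultimately show ?thesis using IH step by simp
  qed
qed


section \<open>Almost squareness\<close>

text \<open>
  The recursion fixes the scale \<open>t n\<close> before \<open>x n\<close>, starting with \<open>t 0 = 1\<close>; then \<open>t (Suc n)\<close> is
  the minimum of \<open>t n\<close> and the gap of \<open>x n\<close>. The bound \<open>t n \<le> 1\<close> makes the sup norms tend to zero.
\<close>

lemma ex_step_function_sequence:
  assumes "locally_compact_space (euclidean :: 'a::{metric_space, zero} topology)"
    and "totally_disconnected (UNIV :: 'a set)"
    and "\<not> uniform_discrete (UNIV :: 'a set)"
    and "0 < \<epsilon>"
  obtains x :: "nat \<Rightarrow> 'a::{metric_space, zero} Lip" and t where
    "\<And>n. x n \<in> S_lip" "\<And>n. norm (x n) = 1" "\<And>n. 0 < t n" "\<And>n. t n \<le> 1"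
    "\<And>n z. \<bar>apply_Lip (x n) z\<bar> \<le> \<epsilon> / 2 ^ (n + 2) * t n"
    "\<And>k n. k < n \<Longrightarrow> const_below (t n) (apply_Lip (x k))"
proof -
  let ?P = "\<lambda>n (g :: 'a Lip, t). g \<in> S_lip \<and> norm g = 1 \<and> 0 < t \<and> t \<le> 1 \<and>
    (\<exists>s>0. const_below s (apply_Lip g)) \<and> (\<forall>z. \<bar>apply_Lip g z\<bar> \<le> \<epsilon> / 2 ^ (n + 2) * t)"
  let ?Q = "\<lambda>(g :: 'a Lip, t) (g' :: 'a Lip, t'). t' \<le> t \<and> const_below t' (apply_Lip g)"
  have ex: "\<exists>g. ?P n (g, t)" if "0 < t" "t \<le> 1" for n t
  proof -
    have "0 < \<epsilon> / 2 ^ (n + 2) * t" using that \<open>0 < \<epsilon>\<close> by simp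
    from ex_small_step_function[OF assms(1-3) this]
    obtain g :: "'a Lip" and s where "g \<in> S_lip" "norm g = 1" "0 < s"
      "const_below s (apply_Lip g)" "\<And>z. \<bar>apply_Lip g z\<bar> \<le> \<epsilon> / 2 ^ (n + 2) * t"
      by blast
    with that show ?thesis by (intro exI[of _ g]) auto
  qed
  have "\<exists>f. \<forall>n. ?P n (f n) \<and> ?Q (f n) (f (Suc n))"
  proof (rule dependent_nat_choice)
    show "\<exists>gt. ?P 0 gt" using ex[OF zero_less_one order_refl, of 0] by blast
    fix gt n assume "?P n gt"
    then obtain g t s where gt: "gt = (g, t)" "0 < t" "t \<le> 1" "0 < s" "const_below s (apply_Lip g)"
      by (cases gt) auto
    then have "0 < min s t" "min s t \<le> 1" by auto
    from ex[OF this, of "Suc n"] obtain g' where "?P (Suc n) (g', min s t)" by blast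
    moreover have "?Q gt (g', min s t)"
      using gt const_below_mono[OF gt(5), of "min s t"] by simp
    ultimately show "\<exists>gt'. ?P (Suc n) gt' \<and> ?Q gt gt'" by blast
  qed
  then obtain f where "\<forall>n. ?P n (f n) \<and> ?Q (f n) (f (Suc n))" ..
  then have f: "?P n (f n)" "?Q (f n) (f (Suc n))" for n by simp_all
  define x where "x n = fst (f n)" for n
  define t where "t n = snd (f n)" for n
  have P: "?P n (x n, t n)" for n using f(1)[of n] by (simp add: x_def t_def)
  have Q: "t (Suc n) \<le> t n" "const_below (t (Suc n)) (apply_Lip (x n))" for n
    using f(2)[of n] by (auto simp: x_def t_def case_prod_beta)
  have "const_below (t n) (apply_Lip (x k))" if "k < n" for k n
    using const_below_mono[OF Q(2)[of k]] decseqD[OF decseq_SucI[of t, OF Q(1)], of "Suc k" n] that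
    by simp
  with P show ?thesis by (intro that[of x t]) auto
qed

text \<open>
  The same functions serve every space between \<open>S(M)\<close> and \<open>lip(M)\<close>: of the given functions \<open>y\<close>,
  the argument uses only that \<open>\<parallel>y\<parallel> = 1\<close> and that their slopes decay at small scales.
\<close>

lemma uasq_between:
  fixes Z :: "'a::{metric_space, zero} Lip set"
  assumes "locally_compact_space (euclidean :: 'a topology)"
    and "totally_disconnected (UNIV :: 'a set)"
    and "\<not> uniform_discrete (UNIV :: 'a set)"
    and Z: "subspace Z" "closed Z" "S_lip \<subseteq> Z" "Z \<subseteq> little_lip"
  shows "uasq Z"
  unfolding uasq_def
proof (intro conjI allI impI Z(1,2))
  fix \<epsilon> :: real assume "0 < \<epsilon>"
  obtain x :: "nat \<Rightarrow> 'a Lip" and t where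
    x: "\<And>n. x n \<in> S_lip" and norm: "\<And>n. norm (x n) = 1"
    and t: "\<And>n. 0 < t n" "\<And>n. t n \<le> 1"
    and small: "\<And>n z. \<bar>apply_Lip (x n) z\<bar> \<le> \<epsilon> / 2 ^ (n + 2) * t n"
    and const: "\<And>k n. k < n \<Longrightarrow> const_below (t n) (apply_Lip (x k))"
    using ex_step_function_sequence[OF assms(1-3) \<open>0 < \<epsilon>\<close>] by blast
  have sup_norm: "\<exists>n. \<forall>z. \<bar>apply_Lip (x n) z\<bar> \<le> \<eta>" if "0 < \<eta>" for \<eta>
  proof -
    obtain n where n: "\<epsilon> / \<eta> < 2 ^ n"
      using real_arch_pow[of 2 "\<epsilon> / \<eta>"] by auto
    have "\<epsilon> < \<eta> * 2 ^ n" using n that by (simp add: field_simps)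
    also have "\<dots> \<le> \<eta> * 2 ^ (n + 2)" using that by simp
    finally have "\<epsilon> / 2 ^ (n + 2) \<le> \<eta>" by (simp add: field_simps)
    moreover have "\<epsilon> / 2 ^ (n + 2) * t n \<le> \<epsilon> / 2 ^ (n + 2) * 1"
      using t(2)[of n] \<open>0 < \<epsilon>\<close> by (intro mult_left_mono) auto
    ultimately have "\<forall>z. \<bar>apply_Lip (x n) z\<bar> \<le> \<eta>"
      using small[of n] by (metis mult_1_right order_trans)
    then show ?thesis ..
  qed
  show "\<exists>X\<subseteq>Z \<inter> sphere 0 1.
      (\<forall>Y \<delta>. finite Y \<longrightarrow> Y \<subseteq> Z \<inter> sphere 0 1 \<longrightarrow> \<delta> > 0 \<longrightarrow>
        {x \<in> X. \<forall>y\<in>Y. norm (y + x) \<le> 1 + \<delta> \<and> norm (y - x) \<le> 1 + \<delta>} \<noteq> {}) \<and>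
      (\<forall>F \<xi>. finite F \<longrightarrow> F \<subseteq> X \<longrightarrow> \<xi> ` F \<subseteq> {-1, 1} \<longrightarrow>
        norm (\<Sum>x\<in>F. \<xi> x *\<^sub>R x) \<le> 1 + \<epsilon>)"
  proof (intro exI[of _ "range x"] conjI allI impI)
    show "range x \<subseteq> Z \<inter> sphere 0 1"
      using x norm Z by auto
  next
    fix Y \<delta> assume Y: "finite Y" "Y \<subseteq> Z \<inter> sphere 0 1" and "(0::real) < \<delta>"
    have "\<forall>y\<in>Y. \<exists>s>0. \<forall>a b. dist a b < s \<longrightarrow>
        \<bar>apply_Lip y a - apply_Lip y b\<bar> \<le> \<delta> * dist a b"
      using Y Z(4) little_lip_slopes_small[OF _ \<open>0 < \<delta>\<close>] by (metis Int_iff subsetD)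
    then obtain s where s: "\<And>y. y \<in> Y \<Longrightarrow> 0 < s y" "\<And>y a b. y \<in> Y \<Longrightarrow> dist a b < s y \<Longrightarrow>
        \<bar>apply_Lip y a - apply_Lip y b\<bar> \<le> \<delta> * dist a b"
      by metis
    \<comment> \<open>A common scale for all of \<open>Y\<close>; the element \<open>1\<close> only provides for empty \<open>Y\<close>.\<close>
    define r where "r = Min (insert 1 (s ` Y))"
    have "0 < r" using s(1) Y(1) by (simp add: r_def)
    have r: "r \<le> s y" if "y \<in> Y" for y using that Y(1) by (simp add: r_def)
    obtain n where n: "\<And>z. \<bar>apply_Lip (x n) z\<bar> \<le> \<delta> / 2 * r"
      using sup_norm[of "\<delta> / 2 * r"] \<open>0 < \<delta>\<close> \<open>0 < r\<close> by auto
    have "norm (y + \<sigma> *\<^sub>R x n) \<le> 1 + \<delta>" if "y \<in> Y" "\<bar>\<sigma>\<bar> = 1" for y \<sigma>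
    proof -
      have "norm (y + \<sigma> *\<^sub>R x n) \<le> max (norm y + 2 * (\<delta> / 2)) (\<delta> + norm (\<sigma> *\<^sub>R x n))"
        using s(2)[OF \<open>y \<in> Y\<close>] r[OF \<open>y \<in> Y\<close>] n \<open>\<bar>\<sigma>\<bar> = 1\<close>
        by (intro norm_add_le_scales[OF \<open>0 < r\<close>])
          (auto simp: scaleR_Lip.rep_eq abs_mult)
      also have "\<dots> = 1 + \<delta>" using that Y norm by auto
      finally show ?thesis .
    qed
    from this[of _ 1] this[of _ "- 1"]
    have "\<forall>y\<in>Y. norm (y + x n) \<le> 1 + \<delta> \<and> norm (y - x n) \<le> 1 + \<delta>" by simp
    then show "{g \<in> range x. \<forall>y\<in>Y. norm (y + g) \<le> 1 + \<delta> \<and> norm (y - g) \<le> 1 + \<delta>} \<noteq> {}"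
      by blast
  next
    fix F :: "'a Lip set" and \<xi> assume F: "finite F" "F \<subseteq> range x" "\<xi> ` F \<subseteq> {-1, 1::real}"
    obtain I where I: "inj_on x I" "F = x ` I" using F(2) by (auto simp: subset_image_inj)
    then have "finite I" using F(1) finite_image_iff by blast
    then obtain n where n: "I \<subseteq> {..<n}" using finite_nat_iff_bounded by blast
    have "(\<Sum>g\<in>F. \<xi> g *\<^sub>R g) = (\<Sum>i\<in>I. \<xi> (x i) *\<^sub>R x i)"
      using I by (simp add: sum.reindex)
    also have "norm \<dots> \<le> 1 + \<epsilon> * (1 - 1 / 2 ^ n)"
    proof (rule norm_signed_sum_le[where t = t])
      show "\<bar>\<xi> (x i)\<bar> = 1" if "i \<in> I" for i
        using F(3) I(2) that by (force simp: image_subset_iff)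
    qed (use \<open>0 < \<epsilon>\<close> norm t small const n in auto)
    also have "\<dots> \<le> 1 + \<epsilon>" using \<open>0 < \<epsilon>\<close> by (simp add: field_simps)
    finally show "norm (\<Sum>g\<in>F. \<xi> g *\<^sub>R g) \<le> 1 + \<epsilon>" .
  qed
qed

theorem theorem3p6:
  assumes "locally_compact_space (euclidean :: 'a::{metric_space, zero} topology)"
    and "totally_disconnected (UNIV :: 'a set)"
    and "\<not> uniform_discrete (UNIV :: 'a set)"
  shows "uasq (little_lip :: 'a Lip set) \<and> uasq (S_lip :: 'a Lip set)"
proof -
  have "S_lip \<subseteq> (little_lip :: 'a Lip set)" by (auto simp: S_lip_def)
  then show ?thesis
    using uasq_between[OF assms subspace_little_lip closed_little_lip]
      uasq_between[OF assms subspace_S_lip closed_S_lip] by simp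
qed

end
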